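(* For any $1\le k<l$, $k\le n$, and any $1<\delta\le 2$, there exists a $\delta$-balanced $(n,k,l)$-splitter of size $O\!\left(\frac{e^{k^2/l}\,k\log n}{(\delta-1)^2}\right)$, where the implied constant is absolute.
   Context: $[n]=\{1,\dots,n\}$ and $\binom{[n]}{k}$ is the family of $k$-element subsets of $[n]$. For a family (multiset) $H$ of functions from $[n]$ to $[l]$ with $k\le l$ and $S\in\binom{[n]}{k}$, $split(S)$ is the number of $h\in H$ that are one-to-one on $S$ (for $k=l$ this is the same as splitting $S$ into parts $h^{-1}(j)\cap S$ of equal size). For $\delta\ge1$, $H$ is a $\delta$-balanced $(n,k,l)$-splitter if there is a real $T>0$ with $T/\delta\le split(S)\le\delta T$ for all $S\in\binom{[n]}{k}$. The size of $H$ is its number of functions.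
   Formalization: The bound uses log max(n,2) in place of log n; this differs only for n = 1, where log n = 0 would force an empty family, which is not a splitter, so the literal bound fails there. *)

theory Defs
  imports Complex_Main "HOL-Library.Multiset" "HOL-Library.FuncSet"
begin

text \<open>
  A family of functions from \<open>[n]\<close> to \<open>[l]\<close> is a finite multiset, so repeated functions
  are counted with multiplicity.
\<close>

definition split_count :: "(nat \<Rightarrow> nat) multiset \<Rightarrow> nat set \<Rightarrow> nat" where
  "split_count H S = size {#h \<in># H. inj_on h S#}"

text \<open>
  The extensional function space makes multiset elements correspond one-to-one to functions
  from \<open>[n]\<close> to \<open>[l]\<close>.
\<close>

definition balanced_splitter ::
  "real \<Rightarrow> nat \<Rightarrow> nat \<Rightarrow> nat \<Rightarrow> (nat \<Rightarrow> nat) multiset \<Rightarrow> bool" where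
  "balanced_splitter \<delta> n k l H \<longleftrightarrow>
     1 \<le> \<delta> \<and> k \<le> l \<and> set_mset H \<subseteq> {1..n} \<rightarrow>\<^sub>E {1..l} \<and>
     (\<exists>T::real. T > 0 \<and>
        (\<forall>S. S \<subseteq> {1..n} \<and> card S = k \<longrightarrow>
           T / \<delta> \<le> real (split_count H S) \<and> real (split_count H S) \<le> \<delta> * T))"

end

theory Submission imports Defs begin

text \<open>
  The fraction \<open>p\<close> of all functions \<open>[n] \<rightarrow> [l]\<close> that are injective on a fixed \<open>k\<close>-set is at least
  \<open>(l / (l - k)) ^ (l - k) * exp (- k) \<ge> exp (- k\<^sup>2 / l)\<close>. Choosing \<open>N\<close> functions at random and
  applying a Chernoff bound to each of the \<open>M = n choose k\<close> sets suffices. The random choice is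
  replaced by a greedy one: with \<open>c = 1 + \<eta>\<close> and \<open>c = 1 / (1 + \<eta>)\<close>, where \<open>\<eta> = (\<delta> - 1) / 3\<close>,
  the functions are chosen one at a time so that the sum over all sets \<open>S\<close> and both values of \<open>c\<close>
  of \<open>c ^ split S / (1 + p * (c - 1)) ^ N\<close> never exceeds its average, \<open>2 * M\<close>. Every single term is
  then at most \<open>2 * M\<close>, which yields both tail bounds once \<open>N * p \<ge> 2 * ln (2 * M) / \<eta>\<^sup>2\<close>.
\<close>

section \<open>Greedy choice of functions by averaging\<close>

lemma exists_le_of_sum_le:
  fixes f :: "'a \<Rightarrow> real"
  assumes "finite F" "F \<noteq> {}" "sum f F \<le> real (card F) * B"
  shows "\<exists>x\<in>F. f x \<le> B"
proof (rule ccontr)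
  assume "\<not> ?thesis"
  then have "sum (\<lambda>_. B) F < sum f F"
    using assms by (intro sum_strict_mono) auto
  with assms show False by simp
qed

text \<open>Method of conditional expectations: each factor has mean 1 over \<open>F\<close>, so
  averaging over the next function leaves the sum unchanged, and some choice does not increase it.
  The empty multiset starts at exactly \<open>card J\<close>.\<close>

lemma exists_mset_sum_prod_le:
  fixes g :: "'j \<Rightarrow> 'a \<Rightarrow> real"
  assumes F: "finite F" "F \<noteq> {}"
    and avg: "\<And>j. j \<in> J \<Longrightarrow> (\<Sum>h\<in>F. g j h) = real (card F)"
  shows "\<exists>H. set_mset H \<subseteq> F \<and> size H = N \<and> (\<Sum>j\<in>J. \<Prod>h\<in>#H. g j h) \<le> real (card J)"
proof (induction N)
  case 0
  show ?case by (intro exI[of _ "{#}"]) simp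
next
  case (Suc N)
  then obtain H where H: "set_mset H \<subseteq> F" "size H = N"
      "(\<Sum>j\<in>J. \<Prod>h\<in>#H. g j h) \<le> real (card J)"
    by blast
  have "(\<Sum>x\<in>F. \<Sum>j\<in>J. g j x * (\<Prod>h\<in>#H. g j h)) =
      (\<Sum>j\<in>J. (\<Sum>x\<in>F. g j x) * (\<Prod>h\<in>#H. g j h))"
    by (subst sum.swap) (simp add: sum_distrib_right)
  also have "\<dots> = real (card F) * (\<Sum>j\<in>J. \<Prod>h\<in>#H. g j h)"
    by (simp add: avg sum_distrib_left)
  also have "\<dots> \<le> real (card F) * real (card J)"
    using H(3) by (intro mult_left_mono) auto
  finally obtain x where "x \<in> F" "(\<Sum>j\<in>J. g j x * (\<Prod>h\<in>#H. g j h)) \<le> real (card J)"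
    using exists_le_of_sum_le[OF F] by blast
  with H show ?case
    by (intro exI[of _ "add_mset x H"]) simp
qed

lemma prod_mset_if_power:
  fixes c d :: real
  shows "(\<Prod>h\<in>#H. (if P h then c else 1) / d) = c ^ size {#h \<in># H. P h#} / d ^ size H"
  by (induction H) auto

text \<open>Logarithmic form of the exponential moment bound: one \<open>H\<close> serves all pairs
  \<open>(S, c)\<close> at once. As \<open>ln c\<close> changes sign at 1, values
  \<open>c > 1\<close> bound the count from above and values \<open>c < 1\<close> from
  below.\<close>

lemma exists_mset_exponential_bound:
  fixes p :: real
  assumes F: "finite F" "F \<noteq> {}" and \<S>: "finite \<S>"
    and p: "0 < p" "p \<le> 1"
    and count: "\<And>S. S \<in> \<S> \<Longrightarrow> real (card {h \<in> F. P h S}) = p * real (card F)"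
    and C: "finite C" "\<And>c. c \<in> C \<Longrightarrow> c > 0"
  shows "\<exists>H. set_mset H \<subseteq> F \<and> size H = N \<and>
    (\<forall>S\<in>\<S>. \<forall>c\<in>C. real (size {#h \<in># H. P h S#}) * ln c
        \<le> ln (real (card \<S> * card C)) + real N * p * (c - 1))"
proof -
  \<comment> \<open>The denominator is the mean of the numerator over \<open>F\<close>, so
    \<open>g\<close> has mean 1.\<close>
  define g where "g = (\<lambda>(S, c) h. (if P h S then c else 1) / (1 + p * (c - 1)))"
  have pos: "1 + p * (c - 1) > 0" if "c \<in> C" for c
  proof -
    have "p * c > 0" using C(2)[OF that] p by simp
    with p show ?thesis by (simp add: algebra_simps)
  qed
  have "(\<Sum>h\<in>F. g j h) = real (card F)" if j: "j \<in> \<S> \<times> C" for j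
  proof -
    obtain S c where [simp]: "j = (S, c)" and S: "S \<in> \<S>" and c: "c \<in> C"
      using j by auto
    have "(\<Sum>h\<in>F. if P h S then c else 1) = (\<Sum>h\<in>F. 1 + (c - 1) * (if P h S then 1 else 0))"
      by (intro sum.cong) auto
    also have "\<dots> = real (card F) + (c - 1) * real (card {h \<in> F. P h S})"
      using F(1) by (simp add: sum.distrib flip: sum_distrib_left sum.inter_filter)
    also have "\<dots> = real (card F) * (1 + p * (c - 1))"
      by (simp add: count S algebra_simps)
    finally show ?thesis
      using pos[OF c] by (simp add: g_def flip: sum_divide_distrib)
  qed
  then obtain H where H: "set_mset H \<subseteq> F" "size H = N"
      and bound: "(\<Sum>j\<in>\<S> \<times> C. \<Prod>h\<in>#H. g j h) \<le> real (card (\<S> \<times> C))"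
    using exists_mset_sum_prod_le[OF F, of "\<S> \<times> C" g N] by auto
  have g: "(\<Prod>h\<in>#H. g (S, c) h) = c ^ size {#h \<in># H. P h S#} / (1 + p * (c - 1)) ^ N" for S c
    unfolding g_def prod.case prod_mset_if_power H(2) ..
  have "real (size {#h \<in># H. P h S#}) * ln c
      \<le> ln (real (card \<S> * card C)) + real N * p * (c - 1)" if S: "S \<in> \<S>" and c: "c \<in> C" for S c
  proof -
    let ?X = "size {#h \<in># H. P h S#}" and ?q = "1 + p * (c - 1)"
    \<comment> \<open>All terms are nonnegative, so the bound on the sum holds for each of
      them.\<close>
    have "(\<Prod>h\<in>#H. g (S, c) h) \<le> (\<Sum>j\<in>\<S> \<times> C. \<Prod>h\<in>#H. g j h)"
    proof (rule member_le_sum)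
      fix j assume "j \<in> \<S> \<times> C - {(S, c)}"
      then obtain S' c' where j: "j = (S', c')" and "c' \<in> C" by auto
      then show "0 \<le> (\<Prod>h\<in>#H. g j h)"
        unfolding j g using C(2)[of c'] pos[of c'] by (intro divide_nonneg_nonneg zero_le_power) auto
    qed (use S c \<S> C(1) in auto)
    also have "\<dots> \<le> real (card \<S> * card C)"
      using bound by (simp add: card_cartesian_product)
    finally have "c ^ ?X \<le> real (card \<S> * card C) * ?q ^ N"
      using pos[OF c] by (simp add: g field_simps)
    then have "ln (c ^ ?X) \<le> ln (real (card \<S> * card C) * ?q ^ N)"
      using C(2)[OF c] by (subst ln_le_cancel_iff) (auto intro: less_le_trans[OF zero_less_power])
    moreover have "real (card \<S> * card C) > 0"
      using S c \<S> C(1) by (auto simp: card_gt_0_iff intro!: mult_pos_pos)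
    ultimately have "real ?X * ln c \<le> ln (real (card \<S> * card C)) + real N * ln ?q"
      using ln_mult_pos[of "real (card \<S> * card C)" "?q ^ N"] zero_less_power[OF pos[OF c], of N]
      by (simp only: ln_realpow)
    also have "real N * ln ?q \<le> real N * (p * (c - 1))"
      using pos[OF c] by (intro mult_left_mono ln_add_one_self_le_self2) auto
    finally show ?thesis by (simp add: mult.assoc)
  qed
  with H show ?thesis by blast
qed

section \<open>Fraction of functions injective on a set\<close>

text \<open>Induction on \<open>k\<close>: with \<open>m = l - Suc k\<close>, the step reduces to
  \<open>(1 + 1 / m) ^ m \<le> exp 1\<close>; \<open>Suc k < l\<close> keeps \<open>m\<close>
  positive.\<close>

lemma prod_falling_ge:
  fixes l k :: nat
  assumes "k < l"
  shows "(real l / real (l - k)) ^ (l - k) * exp (- real k) \<le> (\<Prod>i<k. 1 - real i / real l)"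
  using assms
proof (induction k)
  case 0
  then show ?case by simp
next
  case (Suc k)
  define m where "m = l - Suc k"
  have m: "m > 0" "l - k = Suc m" "real l - real k = real (Suc m)"
    using Suc.prems by (auto simp: m_def)
  have "real (Suc m) / real m \<le> exp (1 / real m)"
    using exp_ge_add_one_self[of "1 / real m"] m by (simp add: field_simps)
  then have "(real (Suc m) / real m) ^ m \<le> exp (1 / real m) ^ m"
    by (intro power_mono) auto
  also have "\<dots> = exp 1"
    using m by (simp flip: exp_of_nat_mult)
  finally have e: "real (Suc m) ^ m \<le> exp 1 * real m ^ m"
    using m by (simp add: power_divide field_simps)
  have "(real l / real m) ^ m * exp (- real (Suc k))
      = real l ^ m * exp (- real k) / (exp 1 * real m ^ m)"
  proof -
    have "exp (- real (Suc k)) = exp (- real k) / exp 1"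
      by (simp flip: exp_diff)
    then show ?thesis by (simp add: power_divide)
  qed
  also have "\<dots> \<le> real l ^ m * exp (- real k) / real (Suc m) ^ m"
    using e m by (intro divide_left_mono mult_pos_pos) auto
  also have "\<dots> = (real l / real (Suc m)) ^ Suc m * exp (- real k) * (1 - real k / real l)"
  proof -
    have "1 - real k / real l = real (Suc m) / real l"
      using Suc.prems m(3) by (simp add: field_simps)
    then show ?thesis
      using Suc.prems by (simp add: power_divide del: of_nat_Suc)
  qed
  also have "\<dots> \<le> (\<Prod>i<k. 1 - real i / real l) * (1 - real k / real l)"
    using Suc m(2) by (intro mult_right_mono) auto
  finally show ?case by (simp add: m_def)
qed

text \<open>From \<open>1 - k / l \<le> exp (- k / l)\<close> the base \<open>l / (l - k)\<close> is
  at least \<open>exp (k / l)\<close>, and the exponents add up to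
  \<open>k * (l - k) / l - k = - k^2 / l\<close>.\<close>

lemma prod_falling_ge_exp:
  fixes l k :: nat
  assumes "k < l"
  shows "exp (- ((real k)\<^sup>2 / real l)) \<le> (\<Prod>i<k. 1 - real i / real l)"
proof -
  have "real (l - k) / real l \<le> exp (- (real k / real l))"
    using exp_ge_add_one_self[of "- (real k / real l)"] assms by (simp add: field_simps of_nat_diff)
  then have "exp (real k / real l) \<le> real l / real (l - k)"
    using assms by (simp add: exp_minus field_simps)
  then have "exp (real k / real l) ^ (l - k) \<le> (real l / real (l - k)) ^ (l - k)"
    by (intro power_mono) auto
  then have "exp (real k / real l) ^ (l - k) * exp (- real k)
      \<le> (real l / real (l - k)) ^ (l - k) * exp (- real k)"
    by simp
  also have "exp (real k / real l) ^ (l - k) * exp (- real k) = exp (- ((real k)\<^sup>2 / real l))"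
    using assms
    by (simp add: of_nat_diff field_simps power2_eq_square flip: exp_of_nat_mult exp_add)
  also note prod_falling_ge[OF assms]
  finally show ?thesis by simp
qed

lemma card_inj_on_PiE_fraction:
  assumes "finite A" "finite B" "S \<subseteq> A" "B \<noteq> {}"
  shows "real (card {h \<in> A \<rightarrow>\<^sub>E B. inj_on h S}) =
    (\<Prod>i<card S. 1 - real i / real (card B)) * real (card (A \<rightarrow>\<^sub>E B))"
proof -
  let ?l = "card B" and ?k = "card S"
  have l: "?l > 0" using assms by (simp add: card_gt_0_iff)
  have k: "?k \<le> card A" using assms by (simp add: card_mono)
  have "real (prod ((-) ?l) {0..<?k}) = (\<Prod>i<?k. (1 - real i / real ?l) * real ?l)"
  proof (cases "?k \<le> ?l")
    case True
    then show ?thesis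
      using l by (auto simp: atLeast0LessThan of_nat_diff algebra_simps intro!: prod.cong)
  next
    \<comment> \<open>If \<open>S\<close> is larger than \<open>B\<close>, the factor with index
      \<open>card B\<close> makes both products vanish.\<close>
    case False
    then have "prod ((-) ?l) {0..<?k} = 0" "(\<Prod>i<?k. (1 - real i / real ?l) * real ?l) = 0"
      using l by (auto simp: prod_zero_iff intro!: bexI[of _ ?l])
    then show ?thesis by (simp only: of_nat_0)
  qed
  also have "\<dots> = (\<Prod>i<?k. 1 - real i / real ?l) * real ?l ^ ?k"
    by (simp add: prod.distrib)
  finally have "real (card {h \<in> A \<rightarrow>\<^sub>E B. inj_on h S}) =
      (\<Prod>i<?k. 1 - real i / real ?l) * (real ?l ^ (card A - ?k) * real ?l ^ ?k)"
    using assms by (simp add: card_inj_on_subset_funcset del: of_nat_prod)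
  also have "real ?l ^ (card A - ?k) * real ?l ^ ?k = real (card (A \<rightarrow>\<^sub>E B))"
    using assms k by (simp add: card_funcsetE flip: power_add)
  finally show ?thesis .
qed

section \<open>Tail estimates\<close>

text \<open>A larger \<open>X\<close> would contradict
  \<open>ln (1 + \<eta>) \<ge> \<eta> - \<eta>^2\<close>: the hypothesis leaves only
  \<open>(\<eta> + \<eta>^2 / 2) * T\<close>, while \<open>\<eta> \<le> 1 / 3\<close> makes the left
  side exceed \<open>(\<eta> + \<eta>^2) * T\<close>.\<close>

lemma upper_tail:
  fixes T X L \<eta> :: real
  assumes \<eta>: "0 < \<eta>" "\<eta> \<le> 1 / 3" and T: "L \<le> T * \<eta>\<^sup>2 / 2" "T > 0"
    and X: "X * ln (1 + \<eta>) \<le> L + T * \<eta>"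
  shows "X \<le> (1 + 3 * \<eta>) * T"
proof (rule ccontr)
  assume "\<not> ?thesis"
  then have gt: "(1 + 3 * \<eta>) * T < X" by simp
  have "(\<eta> + \<eta>\<^sup>2) * T \<le> ((1 + 3 * \<eta>) * (\<eta> - \<eta>\<^sup>2)) * T"
  proof (rule mult_right_mono)
    have "0 \<le> \<eta>\<^sup>2 * (1 - 3 * \<eta>)" using \<eta> by simp
    then show "\<eta> + \<eta>\<^sup>2 \<le> (1 + 3 * \<eta>) * (\<eta> - \<eta>\<^sup>2)"
      by (simp add: algebra_simps power2_eq_square)
  qed (use T in simp)
  also have "\<dots> \<le> (1 + 3 * \<eta>) * T * ln (1 + \<eta>)"
    using ln_one_plus_pos_lower_bound[of \<eta>] \<eta> T
    by (simp add: mult.assoc mult.left_commute)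
  also have "\<dots> < X * ln (1 + \<eta>)"
    using gt \<eta> by (intro mult_strict_right_mono ln_gt_zero) auto
  finally have "(\<eta> + \<eta>\<^sup>2) * T < T * \<eta>\<^sup>2 / 2 + T * \<eta>" using X T by linarith
  moreover have "T * \<eta>\<^sup>2 > 0" using T \<eta> by simp
  ultimately show False by (simp add: algebra_simps)
qed

text \<open>Here \<open>ln (1 + \<eta>) \<le> \<eta>\<close> suffices: dividing by
  \<open>\<eta>\<close> gives \<open>X \<ge> T * (1 / (1 + \<eta>) - \<eta> / 2)\<close>.\<close>

lemma lower_tail:
  fixes T X L \<eta> :: real
  assumes \<eta>: "0 < \<eta>" "\<eta> \<le> 1 / 3" and T: "L \<le> T * \<eta>\<^sup>2 / 2" "T > 0" and "X \<ge> 0"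
    and X: "X * ln (1 / (1 + \<eta>)) \<le> L + T * (1 / (1 + \<eta>) - 1)"
  shows "T / (1 + 3 * \<eta>) \<le> X"
proof -
  have "(1 - 1 / (1 + \<eta>)) * T - T * \<eta>\<^sup>2 / 2 \<le> X * ln (1 + \<eta>)"
    using X T \<eta> by (simp add: ln_div algebra_simps)
  also have "\<dots> \<le> X * \<eta>"
    using ln_add_one_self_le_self[of \<eta>] \<eta> \<open>X \<ge> 0\<close> by (intro mult_left_mono) auto
  finally have "\<eta> * (T * (1 / (1 + \<eta>) - \<eta> / 2)) \<le> \<eta> * X"
    using \<eta> by (simp add: field_simps power2_eq_square)
  then have "T * (1 / (1 + \<eta>) - \<eta> / 2) \<le> X"
    using \<eta> by simp
  \<comment> \<open>Clearing denominators turns this into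
    \<open>(1 + \<eta>) * (1 + 3 * \<eta>) \<le> 4\<close>.\<close>
  moreover have "1 / (1 + 3 * \<eta>) \<le> 1 / (1 + \<eta>) - \<eta> / 2"
  proof -
    have "(1 + \<eta>) * (1 + 3 * \<eta>) \<le> (4 / 3) * 2"
      using \<eta> by (intro mult_mono) auto
    then have "\<eta> * ((1 + \<eta>) * (1 + 3 * \<eta>)) \<le> \<eta> * 4"
      using \<eta> by (intro mult_left_mono) auto
    then show ?thesis
      using \<eta> by (simp add: field_simps)
  qed
  then have "T * (1 / (1 + 3 * \<eta>)) \<le> T * (1 / (1 + \<eta>) - \<eta> / 2)"
    using T by (intro mult_left_mono) auto
  ultimately show ?thesis by simp
qed

section \<open>Existence and size of the splitter\<close>

text \<open>The balancing value \<open>T\<close> is the mean count \<open>N * p\<close>. The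
  constant 18 arises from \<open>\<eta>^2 / 2 = (\<delta> - 1)^2 / 18\<close>, the factor 2 in the
  logarithm from the two values of \<open>c\<close>.\<close>

lemma balanced_splitter_exists:
  fixes n k l N :: nat and \<delta> p :: real
  defines "p \<equiv> \<Prod>i<k. 1 - real i / real l"
  assumes k: "k < l" "k \<le> n" and \<delta>: "1 < \<delta>" "\<delta> \<le> 2"
    and N: "18 * ln (2 * real (n choose k)) / (\<delta> - 1)\<^sup>2 \<le> real N * p"
  shows "\<exists>H. balanced_splitter \<delta> n k l H \<and> size H = N"
proof -
  define \<eta> where "\<eta> = (\<delta> - 1) / 3"
  have \<eta>: "0 < \<eta>" "\<eta> \<le> 1 / 3" and \<delta>_eq: "\<delta> = 1 + 3 * \<eta>"
    using \<delta> by (auto simp: \<eta>_def field_simps)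
  define F where "F = {1..n} \<rightarrow>\<^sub>E {1..l}"
  define \<S> where "\<S> = {S. S \<subseteq> {1..n} \<and> card S = k}"
  define C where "C = {1 + \<eta>, 1 / (1 + \<eta>)}"
  have "1 / (1 + \<eta>) < 1" using \<eta> by simp
  then have "1 + \<eta> \<noteq> 1 / (1 + \<eta>)" using \<eta> by linarith
  then have card_C: "card C = 2" by (simp add: C_def)
  have card_\<S>: "card \<S> = n choose k"
    unfolding \<S>_def using n_subsets[of "{1..n}" k] by simp
  have F: "finite F" "F \<noteq> {}"
    using k by (auto simp: F_def PiE_eq_empty_iff intro: finite_PiE)
  have p: "0 < p" "p \<le> 1"
    using k unfolding p_def by (auto intro!: prod_pos prod_le_1)
  have "n choose k \<ge> 1" using k by (simp add: Suc_leI)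
  then have "ln (2 * real (n choose k)) > 0"
    by (intro ln_gt_zero) linarith
  then have T: "real N * p > 0"
    using \<delta> by (intro less_le_trans[OF _ N] divide_pos_pos) auto
  have count: "real (card {h \<in> F. inj_on h S}) = p * real (card F)" if "S \<in> \<S>" for S
    using that k card_inj_on_PiE_fraction[of "{1..n}" "{1..l}" S]
    by (auto simp: F_def \<S>_def p_def)
  have "\<exists>H. set_mset H \<subseteq> F \<and> size H = N \<and>
    (\<forall>S\<in>\<S>. \<forall>c\<in>C. real (size {#h \<in># H. inj_on h S#}) * ln c
        \<le> ln (real (card \<S> * card C)) + real N * p * (c - 1))"
    by (rule exists_mset_exponential_bound[OF F _ p count])
      (use \<eta> in \<open>auto simp: C_def \<S>_def\<close>)
  then obtain H where H: "set_mset H \<subseteq> F" "size H = N"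
    and bound: "\<And>S c. S \<in> \<S> \<Longrightarrow> c \<in> C \<Longrightarrow> real (split_count H S) * ln c
        \<le> ln (2 * real (n choose k)) + real N * p * (c - 1)"
    by (auto simp: split_count_def card_\<S> card_C mult.commute)
  have L: "ln (2 * real (n choose k)) \<le> real N * p * \<eta>\<^sup>2 / 2"
    using N \<delta> by (simp add: \<eta>_def power_divide field_simps)
  have "real N * p / \<delta> \<le> real (split_count H S) \<and> real (split_count H S) \<le> \<delta> * (real N * p)"
    if S: "S \<in> \<S>" for S
    unfolding \<delta>_eq
    using upper_tail[OF \<eta> L T] lower_tail[OF \<eta> L T] bound[OF S, of "1 + \<eta>"]
      bound[OF S, of "1 / (1 + \<eta>)"]
    by (simp add: C_def)
  then have "balanced_splitter \<delta> n k l H"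
    unfolding balanced_splitter_def
    using \<delta> k H(1) T by (auto simp: F_def \<S>_def intro!: exI[of _ "real N * p"])
  with H show ?thesis by blast
qed

theorem theorem2:
  "\<exists>C::real. C > 0 \<and>
     (\<forall>(n::nat) (k::nat) (l::nat) (\<delta>::real).
        1 \<le> k \<and> k < l \<and> k \<le> n \<and> 1 < \<delta> \<and> \<delta> \<le> 2 \<longrightarrow>
        (\<exists>H. balanced_splitter \<delta> n k l H \<and>
             real (size H) \<le>
               C * (exp ((real k)^2 / real l) * real k * ln (real (max n 2)) / (\<delta> - 1)^2)))"
proof (intro exI[of _ 38] conjI allI impI)
  fix n k l :: nat and \<delta> :: real
  assume "1 \<le> k \<and> k < l \<and> k \<le> n \<and> 1 < \<delta> \<and> \<delta> \<le> 2"
  then have k: "1 \<le> k" "k < l" "k \<le> n" and \<delta>: "1 < \<delta>" "\<delta> \<le> 2" by auto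
  \<comment> \<open>The maximum keeps \<open>ln m\<close> away from 0 when
    \<open>n = 1\<close>.\<close>
  define m where "m = max n 2"
  define p where "p = (\<Prod>i<k. 1 - real i / real l)"
  define E where "E = exp ((real k)\<^sup>2 / real l)"
  define B where "B = real k * ln (real m) / (\<delta> - 1)\<^sup>2"
  \<comment> \<open>The 36 is 18 times the 2 in
    \<open>ln (2 * (n choose k)) \<le> 2 * k * ln m\<close>; \<open>E\<close> compensates for
    \<open>p\<close>, since \<open>E * p \<ge> 1\<close>.\<close>
  define N where "N = nat \<lceil>36 * (E * B)\<rceil>"
  have m: "m \<ge> 2" "m \<ge> n" by (auto simp: m_def)
  have "ln (2::real) \<ge> 1 / 2"
    using ln_le_minus_one[of "1 / 2 :: real"] ln_divide_pos[of 1 "2 :: real"] ln_one[where 'a = real]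
    by linarith
  also have "ln 2 \<le> ln (real m)" using m by simp
  finally have ln_m: "ln (real m) \<ge> 1 / 2" .
  have "1 / 2 \<le> ln (real m)" by (rule ln_m)
  also have "\<dots> \<le> real k * ln (real m)" using k ln_m by simp
  also have "\<dots> \<le> B"
  proof -
    have "(\<delta> - 1)\<^sup>2 \<le> 1" using \<delta> by (intro power_le_one) auto
    then show ?thesis
      using \<delta> ln_m unfolding B_def by (auto simp: pos_le_divide_eq intro!: mult_left_le)
  qed
  finally have B: "B \<ge> 1 / 2" .
  have E: "E \<ge> 1" by (simp add: E_def)
  have EB: "E * B \<ge> 1 / 2"
    using mult_mono[of 1 E "1 / 2" B] E B by simp
  have Ep: "1 \<le> E * p"
    using prod_falling_ge_exp[OF k(2)] by (simp add: E_def p_def exp_minus field_simps)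
  \<comment> \<open>The second power of \<open>m\<close> absorbs the factor 2, as
    \<open>m \<ge> 2\<close> and \<open>k \<ge> 1\<close>.\<close>
  have "2 * (n choose k) \<le> m ^ k * m ^ k"
  proof (rule mult_mono)
    show "2 \<le> m ^ k" using m k self_le_power[of m k] by linarith
    show "n choose k \<le> m ^ k"
      using binomial_le_pow[OF k(3)] power_mono[OF m(2)] by (meson le_trans zero_le)
  qed auto
  then have "real (2 * (n choose k)) \<le> real (m ^ k * m ^ k)"
    by (simp only: of_nat_le_iff)
  then have "2 * real (n choose k) \<le> real m ^ (2 * k)"
    unfolding mult_2[of k] power_add by simp
  then have "ln (2 * real (n choose k)) \<le> ln (real m ^ (2 * k))"
    using k by (intro ln_mono) auto
  also have "\<dots> = 2 * real k * ln (real m)"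
    using m by (simp add: ln_realpow)
  finally have "18 * ln (2 * real (n choose k)) / (\<delta> - 1)\<^sup>2 \<le> 18 * (2 * real k * ln (real m)) / (\<delta> - 1)\<^sup>2"
    by (intro divide_right_mono) auto
  also have "\<dots> = 36 * B * 1" by (simp add: B_def)
  also have "\<dots> \<le> 36 * B * (E * p)"
    using Ep B by (intro mult_left_mono) auto
  also have "\<dots> = 36 * (E * B) * p" by simp
  also have "\<dots> \<le> real N * p"
    unfolding N_def by (intro mult_right_mono real_nat_ceiling_ge)
      (use k in \<open>auto simp: p_def intro!: prod_nonneg\<close>)
  finally obtain H where H: "balanced_splitter \<delta> n k l H" "size H = N"
    using balanced_splitter_exists[OF k(2,3) \<delta>] unfolding p_def by blast
  have "real N \<le> 36 * (E * B) + 1"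
    unfolding N_def using EB by linarith
  \<comment> \<open>Since \<open>E * B \<ge> 1 / 2\<close>, the 1 lost in rounding up is at most
    \<open>2 * (E * B)\<close>.\<close>
  also have "\<dots> \<le> 38 * (E * B)" using EB by linarith
  finally have "real (size H) \<le>
      38 * (exp ((real k)^2 / real l) * real k * ln (real (max n 2)) / (\<delta> - 1)^2)"
    using H(2) by (simp add: E_def B_def m_def mult.assoc)
  with H(1) show "\<exists>H. balanced_splitter \<delta> n k l H \<and> real (size H) \<le>
      38 * (exp ((real k)^2 / real l) * real k * ln (real (max n 2)) / (\<delta> - 1)^2)"
    by blast
qed simp

end
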